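(* For every finite simple undirected graph $G$ on $n$ vertices, $\mathrm{cub}(G) \le \lceil \log_2 n \rceil \, \mathrm{box}(G)$. Moreover, this upper bound is tight: there are infinitely many values of $n$ for which some non-complete graph $G$ on $n$ vertices satisfies $\mathrm{cub}(G) = \lceil \log_2 n \rceil \, \mathrm{box}(G)$.
   Context: All graphs are simple, finite and undirected. An axis-parallel $b$-dimensional box is a Cartesian product $R_1\times\cdots\times R_b$ where each $R_i$ is a closed interval $[a_i,b_i]$ of the real line; a $b$-dimensional cube is such a product where each $R_i$ has the form $[a_i,a_i+1]$. The boxicity $\mathrm{box}(G)$ is the minimum positive integer $b$ such that $G$ is the intersection graph of a family of axis-parallel $b$-dimensional boxes (one box per vertex, two distinct vertices adjacent iff their boxes intersect); the cubicity $\mathrm{cub}(G)$ is the minimum positive integer $b$ such that $G$ is the intersection graph of a family of axis-parallel $b$-dimensional cubes. By convention the boxicity and the cubicity of a complete graph are $0$. Here $\log$ denotes the logarithm to base $2$. *)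

theory Defs
  imports Complex_Main "HOL-Library.FuncSet" "Graph_Theory.Graph_Theory"
begin

text \<open>
  Finite simple undirected graphs are those of the locale \<^locale>\<open>graph\<close>: finite, loop-free
  symmetric digraphs without parallel arcs, in which \<open>u\<close> and \<open>v\<close> are adjacent iff
  \<open>u \<rightarrow>\<^bsub>G\<^esub> v\<close>.
\<close>

definition complete_graph :: "('a, 'b) pre_digraph \<Rightarrow> bool" where
  "complete_graph G \<longleftrightarrow> complete_digraph (card (verts G)) G"

text \<open>
  The dimension \<open>b\<close> has to vary within a formula, so points of \<open>b\<close>-dimensional space are
  functions on \<open>{..<b}\<close> (undefined elsewhere), and products of intervals are taken with
  \<^const>\<open>PiE\<close>.
\<close>

definition is_box :: "nat \<Rightarrow> (nat \<Rightarrow> real) set \<Rightarrow> bool" where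
  "is_box b R \<longleftrightarrow>
     (\<exists>l u. (\<forall>i<b. l i \<le> u i) \<and> R = (\<Pi>\<^sub>E i\<in>{..<b}. {l i..u i}))"

definition is_cube :: "nat \<Rightarrow> (nat \<Rightarrow> real) set \<Rightarrow> bool" where
  "is_cube b R \<longleftrightarrow> (\<exists>l. R = (\<Pi>\<^sub>E i\<in>{..<b}. {l i..l i + 1}))"

definition intersection_representation ::
    "('a, 'b) pre_digraph \<Rightarrow> ('a \<Rightarrow> 'c set) \<Rightarrow> bool" where
  "intersection_representation G R \<longleftrightarrow>
     (\<forall>u\<in>verts G. \<forall>v\<in>verts G. u \<noteq> v \<longrightarrow> (u \<rightarrow>\<^bsub>G\<^esub> v \<longleftrightarrow> R u \<inter> R v \<noteq> {}))"

definition box_representable :: "('a, 'b) pre_digraph \<Rightarrow> nat \<Rightarrow> bool" where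
  "box_representable G b \<longleftrightarrow>
     (\<exists>R. (\<forall>v\<in>verts G. is_box b (R v)) \<and> intersection_representation G R)"

definition cube_representable :: "('a, 'b) pre_digraph \<Rightarrow> nat \<Rightarrow> bool" where
  "cube_representable G b \<longleftrightarrow>
     (\<exists>R. (\<forall>v\<in>verts G. is_cube b (R v)) \<and> intersection_representation G R)"

definition boxicity :: "('a, 'b) pre_digraph \<Rightarrow> nat" where
  "boxicity G = (if complete_graph G then 0 else LEAST b. 0 < b \<and> box_representable G b)"

definition cubicity :: "('a, 'b) pre_digraph \<Rightarrow> nat" where
  "cubicity G = (if complete_graph G then 0 else LEAST b. 0 < b \<and> cube_representable G b)"

text \<open>The minima above range over nonempty sets: one coordinate per vertex is enough.\<close>

lemma cube_representable_imp_box_representable: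
  assumes "cube_representable G b"
  shows "box_representable G b"
proof -
  have "is_box b S" if S: "is_cube b S" for S
  proof -
    obtain l where "S = (\<Pi>\<^sub>E i\<in>{..<b}. {l i..l i + 1})"
      using S unfolding is_cube_def by (rule exE)
    moreover have "\<forall>i<b. l i \<le> l i + 1" by simp
    ultimately show ?thesis
      unfolding is_box_def by (rule_tac x = l in exI, rule_tac x = "\<lambda>i. l i + 1" in exI) (rule conjI)
  qed
  then show ?thesis
    using assms unfolding box_representable_def cube_representable_def by blast
qed

lemma cube_representable_card_verts:
  assumes "graph G"
  shows "cube_representable G (card (verts G))"
proof -
  interpret graph G by fact
  let ?n = "card (verts G)"
  obtain e where e: "bij_betw e {..<?n} (verts G)"
    using ex_bij_betw_nat_finite[OF finite_verts] by (auto simp: atLeast0LessThan)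
  define l :: "'a \<Rightarrow> nat \<Rightarrow> real" where
    "l v i = (if v = e i then 0 else if v \<rightarrow>\<^bsub>G\<^esub> e i then 1 else 2)" for v i
  define R where "R v = (\<Pi>\<^sub>E i\<in>{..<?n}. {l v i..l v i + 1})" for v
  have sym: "u \<rightarrow>\<^bsub>G\<^esub> v \<longleftrightarrow> v \<rightarrow>\<^bsub>G\<^esub> u" for u v
    using arcs_ends_symmetric[OF sym_arcs] by blast
  have "u \<rightarrow>\<^bsub>G\<^esub> v \<longleftrightarrow> R u \<inter> R v \<noteq> {}"
    if uv: "u \<in> verts G" "v \<in> verts G" "u \<noteq> v" for u v
  proof -
    have "R u \<inter> R v \<noteq> {} \<longleftrightarrow> (\<forall>i<?n. {l u i..l u i + 1} \<inter> {l v i..l v i + 1} \<noteq> {})"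
      unfolding R_def PiE_Int by (auto simp: PiE_eq_empty_iff)
    also have "\<dots> \<longleftrightarrow> (\<forall>i<?n. \<bar>l u i - l v i\<bar> \<le> 1)"
      by (auto simp: abs_le_iff)
    also have "\<dots> \<longleftrightarrow> (\<forall>w\<in>verts G. (u = w \<longrightarrow> v \<rightarrow>\<^bsub>G\<^esub> w) \<and> (v = w \<longrightarrow> u \<rightarrow>\<^bsub>G\<^esub> w))"
    proof -
      have "\<bar>l u i - l v i\<bar> \<le> 1 \<longleftrightarrow>
          (u = e i \<longrightarrow> v \<rightarrow>\<^bsub>G\<^esub> e i) \<and> (v = e i \<longrightarrow> u \<rightarrow>\<^bsub>G\<^esub> e i)" for i
        using \<open>u \<noteq> v\<close> by (auto simp: l_def)
      then have "(\<forall>i<?n. \<bar>l u i - l v i\<bar> \<le> 1) \<longleftrightarrow>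
          (\<forall>w\<in>e ` {..<?n}. (u = w \<longrightarrow> v \<rightarrow>\<^bsub>G\<^esub> w) \<and> (v = w \<longrightarrow> u \<rightarrow>\<^bsub>G\<^esub> w))"
        unfolding ball_simps(9) by (simp only: Ball_def lessThan_iff)
      then show ?thesis
        by (simp only: bij_betw_imp_surj_on[OF e])
    qed
    also have "\<dots> \<longleftrightarrow> u \<rightarrow>\<^bsub>G\<^esub> v"
      using uv sym by blast
    finally show ?thesis by blast
  qed
  then have "intersection_representation G R"
    unfolding intersection_representation_def by (intro ballI impI)
  moreover have "is_cube ?n (R v)" for v
    unfolding is_cube_def R_def by (rule exI[of _ "l v"]) (rule refl)
  ultimately show ?thesis
    unfolding cube_representable_def by (intro exI[of _ R] conjI ballI)
qed

end

theory Submission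
  imports Defs
begin

text \<open>
  Upper bound: in each coordinate of an optimal box representation, number the vertices by the
  left endpoints of their intervals \<open>[l v, r v]\<close>. If \<open>u\<close> lies entirely to the left of \<open>v\<close>, then
  \<open>u\<close> has the smaller number, so some binary digit is 0 for \<open>u\<close> and 1 for \<open>v\<close>. Let \<open>\<phi>\<close> be an
  increasing map into \<open>(0, 1)\<close>. For each digit, place the unit interval of \<open>v\<close> at \<open>\<phi> (r v)\<close> if
  the digit of \<open>v\<close> is 0 and at \<open>1 + \<phi> (l v)\<close> if it is 1. Two such intervals are disjoint iff
  the digits are 0 for one vertex \<open>u\<close> and 1 for another vertex \<open>v\<close> with \<open>r u < l v\<close>. So
  \<open>\<lceil>log 2 n\<rceil>\<close> unit interval graphs suffice per coordinate.

  Tightness: in a star, each leaf cube contains a corner of the centre cube and disjoint leaf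
  cubes contain different corners, so \<open>2 ^ k - 1\<close> leaves need dimension at least \<open>k\<close> when \<open>2 \<le> k\<close>,
  whereas the boxicity is 1.
\<close>

section \<open>Intersections of boxes and cubes\<close>

text \<open>In each coordinate the intersection is \<open>{max l l'..min u u'}\<close>; of the four
  inequalities that make it nonempty, the hypotheses supply two.\<close>

lemma boxes_meet_iff:
  fixes l u l' u' :: "nat \<Rightarrow> real"
  assumes "\<And>i. i < b \<Longrightarrow> l i \<le> u i" "\<And>i. i < b \<Longrightarrow> l' i \<le> u' i"
  shows "(\<Pi>\<^sub>E i\<in>{..<b}. {l i..u i}) \<inter> (\<Pi>\<^sub>E i\<in>{..<b}. {l' i..u' i}) \<noteq> {} \<longleftrightarrow>
    (\<forall>i<b. l i \<le> u' i \<and> l' i \<le> u i)"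
  using assms unfolding PiE_Int by (auto simp: PiE_eq_empty_iff)

lemma cubes_meet_iff:
  fixes l l' :: "nat \<Rightarrow> real"
  shows "(\<Pi>\<^sub>E i\<in>{..<b}. {l i..l i + 1}) \<inter> (\<Pi>\<^sub>E i\<in>{..<b}. {l' i..l' i + 1}) \<noteq> {} \<longleftrightarrow>
    (\<forall>i<b. \<bar>l i - l' i\<bar> \<le> 1)"
  by (subst boxes_meet_iff) (auto simp: abs_le_iff)

lemma cube_representable_iff:
  "cube_representable G b \<longleftrightarrow>
    (\<exists>l. \<forall>u\<in>verts G. \<forall>v\<in>verts G. u \<noteq> v \<longrightarrow>
      (u \<rightarrow>\<^bsub>G\<^esub> v \<longleftrightarrow> (\<forall>i<b. \<bar>l u i - l v i :: real\<bar> \<le> 1)))"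
proof
  assume "cube_representable G b"
  then obtain R where R: "\<forall>v\<in>verts G. is_cube b (R v)" "intersection_representation G R"
    unfolding cube_representable_def by blast
  from R(1) obtain l where "\<forall>v\<in>verts G. R v = (\<Pi>\<^sub>E i\<in>{..<b}. {l v i..l v i + 1})"
    unfolding is_cube_def by (auto dest!: bchoice)
  then have "R u \<inter> R v \<noteq> {} \<longleftrightarrow> (\<forall>i<b. \<bar>l u i - l v i\<bar> \<le> 1)"
    if "u \<in> verts G" "v \<in> verts G" for u v
    using that by (simp only: cubes_meet_iff)
  with R(2) show "\<exists>l. \<forall>u\<in>verts G. \<forall>v\<in>verts G. u \<noteq> v \<longrightarrow>
      (u \<rightarrow>\<^bsub>G\<^esub> v \<longleftrightarrow> (\<forall>i<b. \<bar>l u i - l v i :: real\<bar> \<le> 1))"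
    unfolding intersection_representation_def by (intro exI[of _ l]) simp
next
  assume "\<exists>l. \<forall>u\<in>verts G. \<forall>v\<in>verts G. u \<noteq> v \<longrightarrow>
      (u \<rightarrow>\<^bsub>G\<^esub> v \<longleftrightarrow> (\<forall>i<b. \<bar>l u i - l v i :: real\<bar> \<le> 1))"
  then obtain l where l: "\<forall>u\<in>verts G. \<forall>v\<in>verts G. u \<noteq> v \<longrightarrow>
      (u \<rightarrow>\<^bsub>G\<^esub> v \<longleftrightarrow> (\<forall>i<b. \<bar>l u i - l v i :: real\<bar> \<le> 1))" ..
  show "cube_representable G b"
    unfolding cube_representable_def intersection_representation_def is_cube_def
    by (intro exI[of _ "\<lambda>v. \<Pi>\<^sub>E i\<in>{..<b}. {l v i..l v i + 1}"])
      (use l in \<open>auto simp only: cubes_meet_iff\<close>)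
qed

lemma box_representable_iff:
  "box_representable G b \<longleftrightarrow>
    (\<exists>l r :: _ \<Rightarrow> nat \<Rightarrow> real. (\<forall>v\<in>verts G. \<forall>i<b. l v i \<le> r v i) \<and>
      (\<forall>u\<in>verts G. \<forall>v\<in>verts G. u \<noteq> v \<longrightarrow>
        (u \<rightarrow>\<^bsub>G\<^esub> v \<longleftrightarrow> (\<forall>i<b. l u i \<le> r v i \<and> l v i \<le> r u i))))"
    (is "_ \<longleftrightarrow> (\<exists>l r. ?P l r)")
proof
  assume "box_representable G b"
  then obtain R where R: "\<forall>v\<in>verts G. is_box b (R v)" "intersection_representation G R"
    unfolding box_representable_def by blast
  from R(1) obtain l r where
    "\<forall>v\<in>verts G. (\<forall>i<b. l v i \<le> r v i) \<and> R v = (\<Pi>\<^sub>E i\<in>{..<b}. {l v i..r v i})"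
    unfolding is_box_def bchoice_iff by blast
  moreover from this have "R u \<inter> R v \<noteq> {} \<longleftrightarrow> (\<forall>i<b. l u i \<le> r v i \<and> l v i \<le> r u i)"
    if "u \<in> verts G" "v \<in> verts G" for u v
    using that boxes_meet_iff[of b "l u" "r u" "l v" "r v"] by simp
  ultimately have "?P l r"
    using R(2) unfolding intersection_representation_def by simp
  then show "\<exists>l r. ?P l r" by blast
next
  assume "\<exists>l r. ?P l r"
  then obtain l r where lr: "?P l r" by blast
  let ?R = "\<lambda>v. \<Pi>\<^sub>E i\<in>{..<b}. {l v i..r v i}"
  have "is_box b (?R v)" if "v \<in> verts G" for v
    unfolding is_box_def using lr that by blast
  moreover have "intersection_representation G ?R"
    using lr unfolding intersection_representation_def by (simp add: boxes_meet_iff)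
  ultimately show "box_representable G b"
    unfolding box_representable_def by (intro exI[of _ ?R]) simp
qed

section \<open>Interval graphs as intersections of unit interval graphs\<close>

text \<open>Induction splitting off the last digit: if the halves are still in strict order, their
  separating digit moves up one place; otherwise the halves agree and the last digits are 0 and
  1.\<close>

lemma less_imp_separating_digit:
  fixes i j :: nat
  assumes "i < j" "j < 2 ^ k"
  shows "\<exists>b<k. \<not> bit i b \<and> bit j b"
  using assms
proof (induction k arbitrary: i j)
  case (Suc k)
  show ?case
  proof (cases "i div 2 < j div 2")
    case True
    moreover have "j div 2 < 2 ^ k" using Suc.prems by simp
    ultimately obtain b where "b < k" "\<not> bit (i div 2) b" "bit (j div 2) b"
      using Suc.IH by blast
    then show ?thesis by (intro exI[of _ "Suc b"]) (simp add: bit_Suc)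
  next
    case False
    with Suc.prems have "even i" "odd j" by presburger+
    then show ?thesis by (intro exI[of _ 0]) (simp add: bit_0)
  qed
qed simp

text \<open>The rank counts the elements of strictly smaller value; no element counts itself, so
  ranks stay below \<open>card V\<close>. Ties may share a rank, since disjoint intervals have
  different left endpoints.\<close>

lemma ex_ranking:
  fixes f :: "'a \<Rightarrow> real"
  assumes "finite V"
  shows "\<exists>rk :: 'a \<Rightarrow> nat. (\<forall>v\<in>V. rk v < card V) \<and>
    (\<forall>u\<in>V. \<forall>v\<in>V. f u < f v \<longrightarrow> rk u < rk v)"
proof (intro exI conjI ballI impI)
  define rk where "rk v = card {w \<in> V. f w < f v}" for v
  show "rk v < card V" if "v \<in> V" for v
    unfolding rk_def using assms that by (intro psubset_card_mono) auto
  show "rk u < rk v" if "u \<in> V" "v \<in> V" "f u < f v" for u v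
    unfolding rk_def using assms that by (intro psubset_card_mono) auto
qed

lemma interval_graph_unit_coordinates:
  fixes l r :: "'a \<Rightarrow> real"
  assumes "finite V" "card V \<le> 2 ^ k" and le: "\<forall>v\<in>V. l v \<le> r v"
  shows "\<exists>c. \<forall>u\<in>V. \<forall>v\<in>V.
    (\<forall>j<k. \<bar>c u j - c v j :: real\<bar> \<le> 1) \<longleftrightarrow> l u \<le> r v \<and> l v \<le> r u"
proof -
  obtain rk :: "'a \<Rightarrow> nat" where rk: "\<forall>v\<in>V. rk v < card V"
    "\<forall>u\<in>V. \<forall>v\<in>V. l u < l v \<longrightarrow> rk u < rk v"
    using ex_ranking[OF assms(1)] by blast
  \<comment> \<open>The range (0, 1) keeps positions with equal digits less than 1 apart. With
    different digits the distance is \<open>1 + \<phi> (l v) - \<phi> (r u)\<close>, which exceeds 1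
    exactly if \<open>r u < l v\<close>.\<close>
  define \<phi> :: "real \<Rightarrow> real" where "\<phi> x = arctan x / pi + 1 / 2" for x
  have \<phi>_bounds: "0 < \<phi> x" "\<phi> x < 1" for x
    using arctan_bounded[of x] pi_gt_zero by (auto simp: \<phi>_def field_simps)
  have \<phi>_le: "\<phi> x \<le> \<phi> y \<longleftrightarrow> x \<le> y" for x y
    by (simp add: \<phi>_def divide_le_cancel arctan_le_iff)
  define c where "c v j = (if bit (rk v) j then 1 + \<phi> (l v) else \<phi> (r v))" for v j
  have meet: "\<bar>c u j - c v j\<bar> \<le> 1" if "l u \<le> r v" "l v \<le> r u" for u v j
    using that \<phi>_bounds[of "l u"] \<phi>_bounds[of "l v"] \<phi>_bounds[of "r u"] \<phi>_bounds[of "r v"]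
      \<phi>_le[of "l u" "r v"] \<phi>_le[of "l v" "r u"]
    by (auto simp: c_def abs_le_iff)
  have separate: "\<exists>j<k. \<bar>c u j - c v j\<bar> > 1" if uv: "u \<in> V" "v \<in> V" "r u < l v" for u v
  proof -
    \<comment> \<open>Ranking by left endpoints suffices, because
      \<open>l u \<le> r u < l v\<close>.\<close>
    have "rk u < rk v" using rk(2) le uv by force
    moreover have "rk v < 2 ^ k" using rk(1) assms(2) uv by fastforce
    ultimately obtain j where j: "j < k" "\<not> bit (rk u) j" "bit (rk v) j"
      using less_imp_separating_digit by blast
    have "\<phi> (r u) < \<phi> (l v)" using \<phi>_le[of "l v" "r u"] uv by simp
    with j show ?thesis by (intro exI[of _ j]) (simp add: c_def)
  qed
  have "(\<forall>j<k. \<bar>c u j - c v j\<bar> \<le> 1) \<longleftrightarrow> l u \<le> r v \<and> l v \<le> r u" if "u \<in> V" "v \<in> V" for u v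
    using meet[of u v] separate[of u v] separate[of v u] that
    by (metis abs_minus_commute not_le)
  then show ?thesis by blast
qed

section \<open>The upper bound\<close>

text \<open>The pair (i, j) is coded as \<open>i * k + j\<close>, so the \<open>k\<close> unit
  coordinates that replace one box coordinate form a block.\<close>

lemma all_less_mult_iff:
  fixes b k :: nat
  shows "(\<forall>m<b * k. P (m div k) (m mod k)) \<longleftrightarrow> (\<forall>i<b. \<forall>j<k. P i j)"
proof (intro iffI allI impI)
  fix i j assume all: "\<forall>m<b * k. P (m div k) (m mod k)" and ij: "i < b" "j < k"
  have "i * k + j < Suc i * k" using ij by simp
  also have "\<dots> \<le> b * k" using ij by (intro mult_le_mono1) simp
  finally show "P i j" using all[rule_format, of "i * k + j"] ij by simp
next
  fix m assume P: "\<forall>i<b. \<forall>j<k. P i j" and m: "m < b * k"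
  then have "0 < k" by (cases k) auto
  with P m show "P (m div k) (m mod k)"
    by (simp add: less_mult_imp_div_less)
qed

lemma box_imp_cube_representable:
  assumes "finite (verts G)" "card (verts G) \<le> 2 ^ k" "box_representable G b"
  shows "cube_representable G (b * k)"
proof -
  obtain l r :: "_ \<Rightarrow> nat \<Rightarrow> real" where le: "\<forall>v\<in>verts G. \<forall>i<b. l v i \<le> r v i"
    and adj: "\<forall>u\<in>verts G. \<forall>v\<in>verts G. u \<noteq> v \<longrightarrow>
      (u \<rightarrow>\<^bsub>G\<^esub> v \<longleftrightarrow> (\<forall>i<b. l u i \<le> r v i \<and> l v i \<le> r u i))"
    using assms(3) unfolding box_representable_iff by blast
  have "\<exists>c. \<forall>u\<in>verts G. \<forall>v\<in>verts G.
      (\<forall>j<k. \<bar>c u j - c v j :: real\<bar> \<le> 1) \<longleftrightarrow> l u i \<le> r v i \<and> l v i \<le> r u i" if "i < b" for i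
    using interval_graph_unit_coordinates[OF assms(1,2), of "\<lambda>v. l v i" "\<lambda>v. r v i"] le that
    by blast
  then obtain c where c: "\<And>i u v. i < b \<Longrightarrow> u \<in> verts G \<Longrightarrow> v \<in> verts G \<Longrightarrow>
      (\<forall>j<k. \<bar>c i u j - c i v j :: real\<bar> \<le> 1) \<longleftrightarrow> l u i \<le> r v i \<and> l v i \<le> r u i"
    by metis
  let ?c = "\<lambda>v m. c (m div k) v (m mod k)"
  have "u \<rightarrow>\<^bsub>G\<^esub> v \<longleftrightarrow> (\<forall>m<b * k. \<bar>?c u m - ?c v m\<bar> \<le> 1)"
    if "u \<in> verts G" "v \<in> verts G" "u \<noteq> v" for u v
    using adj c that unfolding all_less_mult_iff[of b k "\<lambda>i j. \<bar>c i u j - c i v j\<bar> \<le> 1"]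
    by simp
  then show ?thesis
    unfolding cube_representable_iff by (intro exI[of _ ?c]) blast
qed

text \<open>With at most one vertex and no loops there are no arcs, and such a graph is complete.
  The bound makes \<open>card (verts G)\<close> a positive dimension.\<close>

lemma card_verts_ge_2:
  assumes "graph G" "\<not> complete_graph G"
  shows "2 \<le> card (verts G)"
proof (rule ccontr)
  interpret graph G by fact
  assume "\<not> 2 \<le> card (verts G)"
  then have "u = v" if "u \<in> verts G" "v \<in> verts G" for u v
    using card_le_Suc0_iff_eq[OF finite_verts] that by auto
  then have "arcs_ends G = {(u, v). (u, v) \<in> verts G \<times> verts G \<and> u \<noteq> v}"
    using no_loops by (fastforce simp: arcs_ends_def arc_to_ends_def)
  then show False
    using assms unfolding complete_graph_def complete_digraph_def by blast
qed

lemma boxicity_representable: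
  assumes "graph G" "\<not> complete_graph G"
  shows "0 < boxicity G" "box_representable G (boxicity G)"
proof -
  have "0 < card (verts G) \<and> box_representable G (card (verts G))"
    using card_verts_ge_2[OF assms] cube_representable_card_verts[OF assms(1)]
    by (auto intro: cube_representable_imp_box_representable)
  then have "0 < boxicity G \<and> box_representable G (boxicity G)"
    using assms(2) unfolding boxicity_def by (simp only: if_False) (rule LeastI)
  then show "0 < boxicity G" "box_representable G (boxicity G)" by blast+
qed

lemma cubicity_representable:
  assumes "graph G" "\<not> complete_graph G"
  shows "cube_representable G (cubicity G)"
proof -
  have "0 < card (verts G) \<and> cube_representable G (card (verts G))"
    using card_verts_ge_2[OF assms] cube_representable_card_verts[OF assms(1)] by auto
  then have "0 < cubicity G \<and> cube_representable G (cubicity G)"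
    using assms(2) unfolding cubicity_def by (simp only: if_False) (rule LeastI)
  then show ?thesis by blast
qed

lemma cubicity_le_log_boxicity:
  assumes "graph G"
  shows "int (cubicity G) \<le> \<lceil>log 2 (real (card (verts G)))\<rceil> * int (boxicity G)"
proof (cases "complete_graph G")
  case True
  then show ?thesis by (simp add: cubicity_def boxicity_def)
next
  case False
  interpret graph G by fact
  let ?n = "card (verts G)"
  define k where "k = nat \<lceil>log 2 (real ?n)\<rceil>"
  have n: "2 \<le> ?n" using card_verts_ge_2[OF assms False] .
  then have "0 < log 2 (real ?n)" by simp
  then have k: "int k = \<lceil>log 2 (real ?n)\<rceil>" "0 < k" unfolding k_def by simp_all
  have "log 2 (real ?n) \<le> real k"
    using le_of_int_ceiling[of "log 2 (real ?n)"] unfolding k(1)[symmetric] by simp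
  then have "real ?n \<le> 2 powr real k" using n by (simp add: log_le_iff)
  then have "?n \<le> 2 ^ k" by (simp add: powr_realpow)
  then have "cube_representable G (boxicity G * k)"
    by (intro box_imp_cube_representable finite_verts boxicity_representable(2) assms False)
  moreover have "0 < boxicity G * k"
    using boxicity_representable(1)[OF assms False] k(2) by simp
  ultimately have "cubicity G \<le> boxicity G * k"
    using False unfolding cubicity_def by (simp add: Least_le)
  then show ?thesis
    unfolding k(1)[symmetric] by (simp add: mult.commute flip: of_nat_mult)
qed

section \<open>Stars\<close>

text \<open>\<open>n\<close> counts the centre 0 and the leaves 1, ..., n - 1. Each arc is the pair
  of its ends, which excludes parallel arcs.\<close>

definition star :: "nat \<Rightarrow> (nat, nat \<times> nat) pre_digraph" where
  "star n = \<lparr>verts = {..<n}, arcs = {(u, v). u < n \<and> v < n \<and> (u = 0) \<noteq> (v = 0)},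
    tail = fst, head = snd\<rparr>"

lemma verts_star [simp]: "verts (star n) = {..<n}"
  by (simp add: star_def)

lemma star_adj_iff: "u \<rightarrow>\<^bsub>star n\<^esub> v \<longleftrightarrow> u < n \<and> v < n \<and> (u = 0) \<noteq> (v = 0)"
  by (force simp: star_def arcs_ends_def arc_to_ends_def)

lemma graph_star: "graph (star n)"
proof
  have "arcs (star n) \<subseteq> {..<n} \<times> {..<n}" by (auto simp: star_def)
  then show "finite (arcs (star n))" by (rule finite_subset) simp
  show "symmetric (star n)"
    unfolding symmetric_def sym_def star_adj_iff by blast
qed (auto simp: star_def arc_to_ends_def)

lemma star_not_complete:
  assumes "3 \<le> n"
  shows "\<not> complete_graph (star n)"
proof
  assume "complete_graph (star n)"
  then have "1 \<rightarrow>\<^bsub>star n\<^esub> 2"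
    using assms by (auto simp: complete_graph_def complete_digraph_def)
  then show False by (simp add: star_adj_iff)
qed

lemma boxicity_star:
  assumes "3 \<le> n"
  shows "boxicity (star n) = 1"
proof -
  have "box_representable (star n) 1"
    unfolding box_representable_iff
    \<comment> \<open>The centre gets the interval [0, n], the leaf \<open>v\<close> the single
      point \<open>v\<close>.\<close>
    by (rule exI[of _ "\<lambda>v _. real v"], rule exI[of _ "\<lambda>v _. if v = 0 then real n else real v"])
      (auto simp: star_adj_iff)
  then have "(LEAST b. 0 < b \<and> box_representable (star n) b) = 1"
    by (intro Least_equality) auto
  then show ?thesis
    using star_not_complete[OF assms] by (simp add: boxicity_def)
qed

text \<open>Relative to the centre cube, the lower end of a leaf cube lies in \<open>[-1, 1]\<close> in every
  coordinate; its sign pattern tells which corner of the centre cube the leaf cube contains.\<close>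

lemma card_leaves_star_le:
  assumes "cube_representable (star n) b"
  shows "n - 1 \<le> 2 ^ b"
proof -
  obtain l where l: "\<And>u v. u < n \<Longrightarrow> v < n \<Longrightarrow> u \<noteq> v \<Longrightarrow>
      (u = 0) \<noteq> (v = 0) \<longleftrightarrow> (\<forall>i<b. \<bar>l u i - l v i :: real\<bar> \<le> 1)"
    using assms unfolding cube_representable_iff star_adj_iff by (metis lessThan_iff verts_star)
  define s where "s v = {i \<in> {..<b}. l v i \<le> l 0 i}" for v
  have "inj_on s {1..<n}"
  proof (rule inj_onI, rule ccontr)
    fix u v assume uv: "u \<in> {1..<n}" "v \<in> {1..<n}" "s u = s v" "u \<noteq> v"
    \<comment> \<open>The offsets of \<open>u\<close> and \<open>v\<close> from the centre lie both
      in [-1, 0] or both in (0, 1], so the two leaves would be adjacent.\<close>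
    have "\<bar>l u i - l v i\<bar> \<le> 1" if i: "i < b" for i
    proof -
      have "\<bar>l 0 i - l u i\<bar> \<le> 1" "\<bar>l 0 i - l v i\<bar> \<le> 1"
        using l[of 0 u] l[of 0 v] uv i by auto
      moreover have "l u i \<le> l 0 i \<longleftrightarrow> l v i \<le> l 0 i"
        using uv(3) i unfolding s_def by blast
      ultimately show ?thesis by linarith
    qed
    then show False using l[of u v] uv by auto
  qed
  moreover have "s ` {1..<n} \<subseteq> Pow {..<b}" by (auto simp: s_def)
  ultimately have "card {1..<n} \<le> card (Pow {..<b})"
    by (intro card_inj_on_le) auto
  then show ?thesis by (simp add: card_Pow)
qed

lemma cubicity_star_power_2:
  assumes "2 \<le> k"
  shows "cubicity (star (2 ^ k)) = k"
proof (rule antisym)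
  have n: "3 \<le> (2 :: nat) ^ k"
    using power_increasing[OF assms, of "2 :: nat"] by simp
  have "int (cubicity (star (2 ^ k))) \<le> int k"
    using cubicity_le_log_boxicity[OF graph_star, of "2 ^ k"] boxicity_star[OF n]
    by (simp add: log_nat_power)
  then show "cubicity (star (2 ^ k)) \<le> k" by simp
  show "k \<le> cubicity (star (2 ^ k))" (is "_ \<le> ?c")
  proof (rule ccontr)
    assume "\<not> k \<le> ?c"
    \<comment> \<open>Together with the leaf count this forces \<open>2 ^ ?c \<le> 1\<close> and
      hence \<open>2 ^ k \<le> 2\<close>, contrary to \<open>2 \<le> k\<close>.\<close>
    then have "2 * 2 ^ ?c \<le> (2 :: nat) ^ k"
      using power_increasing[of "Suc ?c" k "2 :: nat"] by simp
    moreover have "2 ^ k - 1 \<le> (2 :: nat) ^ ?c"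
      by (intro card_leaves_star_le cubicity_representable graph_star star_not_complete n)
    ultimately show False using n power_increasing[OF assms, of "2 :: nat"] by simp
  qed
qed

theorem theorem1:
  shows "(\<forall>G :: ('a, 'b) pre_digraph. graph G \<longrightarrow>
            int (cubicity G) \<le> \<lceil>log 2 (real (card (verts G)))\<rceil> * int (boxicity G))
       \<and> infinite {n. \<exists>G :: (nat, nat \<times> nat) pre_digraph.
            graph G \<and> card (verts G) = n \<and> \<not> complete_graph G \<and>
            int (cubicity G) = \<lceil>log 2 (real n)\<rceil> * int (boxicity G)}"
    (is "_ \<and> infinite ?S")
proof
  show "\<forall>G :: ('a, 'b) pre_digraph. graph G \<longrightarrow>
      int (cubicity G) \<le> \<lceil>log 2 (real (card (verts G)))\<rceil> * int (boxicity G)"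
    using cubicity_le_log_boxicity by blast
  \<comment> \<open>At powers of two the logarithm is the integer \<open>k\<close>, so rounding up
    changes nothing.\<close>
  have "2 ^ k \<in> ?S" if k: "2 \<le> k" for k :: nat
  proof -
    have n: "3 \<le> (2 :: nat) ^ k"
      using power_increasing[OF k, of "2 :: nat"] by simp
    show ?thesis
      using graph_star star_not_complete[OF n] cubicity_star_power_2[OF k] boxicity_star[OF n]
      by (auto intro!: exI[of _ "star (2 ^ k)"] simp: log_nat_power)
  qed
  then have "(\<lambda>k. 2 ^ k) ` {2 :: nat..} \<subseteq> ?S" by auto
  moreover have "infinite ((\<lambda>k. 2 ^ k :: nat) ` {2 :: nat..})"
    by (subst finite_image_iff) (auto simp: inj_on_def infinite_Ici)
  ultimately show "infinite ?S" using infinite_super by blast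
qed

end
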